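(* Consider the closed-loop system consisting of the physical AC network model $$\dot\vartheta_{ij}=\omega_i-\omega_j,\quad (i,j)\in\mathcal E_p,$$ $$\dot L_i=-A_i\omega_i+p_{g,i}-p_{\ell,i}-p_i,\quad i\in\mathcal V_{\mathcal G}\cup\mathcal V_{\mathcal I},$$ $$\tau_{d,i}\dot U_i=U_{f,i}-U_i-(X_{d,i}-X_{d,i}')U_i^{-1}q_i,\quad i\in\mathcal V_{\mathcal G},$$ $$0=-A_i\omega_i-p_{\ell,i}-p_i,\qquad 0=-q_{\ell,i}-q_i,\quad i\in\mathcal V_{\mathcal L},$$ with $$p_i=\sum_{j\in\mathcal N_i}B_{ij}U_iU_j\sin\vartheta_{ij}+G_{ii}U_i^2+\sum_{j\in\mathcal N_i}G_{ij}U_iU_j\cos\vartheta_{ij},$$ $$q_i=-\sum_{j\in\mathcal N_i}B_{ij}U_iU_j\cos\vartheta_{ij}+B_{ii}U_i^2+\sum_{j\in\mathcal N_i}G_{ij}U_iU_j\sin\vartheta_{ij}$$ for all $i\in\mathcal V$, together with the controller $$\tau_g\dot p_g=-\nabla C(p_g)+\lambda-\omega+\mu_{g-}-\mu_{g+},$$ $$\tau_{U_{\mathcal G}}\dot U_f=\mu_{\mathcal G-}-\mu_{\mathcal G+},\qquad \tau_{U_{\mathcal I}}\dot U_{\mathcal I}=-\mu_{\mathcal I-}+\mu_{\mathcal I+},$$ $$\tau_{\mu_{g-}}\dot\mu_{g-}=\langle\underline p_g-p_g\rangle^+_{\mu_{g-}},\qquad \tau_{\mu_{g+}}\dot\mu_{g+}=\langle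 p_g-\overline p_g\rangle^+_{\mu_{g+}},$$ $$\tau_{\mu_{\mathcal G-}}\dot\mu_{\mathcal G-}=\langle\underline U_f-U_f\rangle^+_{\mu_{\mathcal G-}},\qquad \tau_{\mu_{\mathcal G+}}\dot\mu_{\mathcal G+}=\langle U_f-\overline U_f\rangle^+_{\mu_{\mathcal G+}},$$ $$\tau_{\mu_{\mathcal I-}}\dot\mu_{\mathcal I-}=\langle\underline U_{\mathcal I}-U_{\mathcal I}\rangle^+_{\mu_{\mathcal I-}},\qquad \tau_{\mu_{\mathcal I+}}\dot\mu_{\mathcal I+}=\langle U_{\mathcal I}-\overline U_{\mathcal I}\rangle^+_{\mu_{\mathcal I+}},$$ $$\tau_\lambda\dot\lambda=-p_g+\varphi+p_\ell-D_c\nu,\qquad \tau_\nu\dot\nu=D_c^\top\lambda .$$ Then at each equilibrium of this closed-loop system, $\omega_i=0$ for all $i\in\mathcal V$.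
   Context: Physical network: a connected directed graph $\mathscr G_p=(\mathcal V,\mathcal E_p)$ with finite node set partitioned as $\mathcal V=\mathcal V_{\mathcal G}\cup\mathcal V_{\mathcal I}\cup\mathcal V_{\mathcal L}$ (generator, inverter, load nodes). $\mathcal N_i$ is the set of nodes adjacent to $i$, ignoring edge direction. $\vartheta_{ij}$ is the voltage angle difference between $i$ and $j$ (so $\vartheta_{ji}=-\vartheta_{ij}$), $\omega_i$ the frequency deviation from its nominal value, $U_i>0$ the voltage magnitude, $U_{f,i}$ the excitation voltage ($i\in\mathcal V_{\mathcal G}$), and $L_i=M_i\omega_i$ the angular momentum deviation with $M_i>0$ ($i\in\mathcal V_{\mathcal G}\cup\mathcal V_{\mathcal I}$). $A_i>0$ (all $i\in\mathcal V$), $\tau_{d,i}>0$ and $X_{d,i}-X_{d,i}'$ are constants; $B_{ij}=B_{ji}$ and $G_{ij}=G_{ji}$ are the negatives of the susceptance and conductance of the line between $i$ and $j$; $B_{ii}=-b_i-\sum_{j\in\mathcal N_i}B_{ij}$ and $G_{ii}=-g_i-\sum_{j\in\mathcal N_i}G_{ij}$ with shunt susceptance $b_i$ and shunt conductance $g_i$. The consumptions $p_{\ell,i},q_{\ell,i}$ are given constants. Controller: $p_g$ collects the generations $p_{g,i}$, $i\in\mathcal V_{\mathcal G}\cup\mathcal V_{\mathcal I}$ (with zero entries at load nodes in the $\lambda$-equation; in the $p_g$-equation $\lambda$ and $\omega$ are restricted to $\mathcal V_{\mathcal G}\cup\mathcal V_{\mathcal I}$). $U_f$ collects $U_{f,i}$,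 $i\in\mathcal V_{\mathcal G}$, and $U_{\mathcal I}$ collects $U_i$, $i\in\mathcal V_{\mathcal I}$. $\lambda=(\lambda_i)_{i\in\mathcal V}$ are nodal prices, and $\nu$ and $\mu_{(\cdot)}\ge 0$ are vectors of multipliers. $C(p_g)=\sum_i C_i(p_{g,i})$ with each $C_i$ convex and differentiable. All $\tau_{(\cdot)}$ in the controller are positive definite diagonal matrices. Underlined and overlined quantities are given constant lower and upper bounds. $\varphi=(\varphi_i)_{i\in\mathcal V}$ with $\varphi_i=G_{ii}U_i^2+\sum_{j\in\mathcal N_i}G_{ij}U_iU_j\cos\vartheta_{ij}$. For $\mu\ge0$: $\langle x\rangle^+_\mu=x$ if $\mu>0$ or $x\ge0$, and $\langle x\rangle^+_\mu=0$ otherwise, applied componentwise to vectors. Cells: $\mathcal V$ is partitioned into cells $\mathcal V_k^{\mathcal Z}$, $k\in\mathcal Z$. For each $k$, $D_c^k$ is the node-edge incidence matrix (each column has one entry $+1$, one entry $-1$, and zeros elsewhere) of a connected communication graph on $\mathcal V_k^{\mathcal Z}$, and $D_c$ is the block-diagonal matrix with blocks $D_c^k$, $k\in\mathcal Z$. An equilibrium is a point satisfying the algebraic equations at which all time derivatives vanish. *)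

theory Defs
  imports "HOL-Analysis.Analysis" "Graph_Theory.Graph_Theory"
begin

text \<open>
  Nodes have type \<open>'v\<close>, cells are indexed by \<open>'k\<close>, and the edges of the communication graphs have
  type \<open>'e\<close>.  All vectors are functions that are only read on their index set, and a positive
  definite diagonal matrix is given by its positive diagonal entries.

  The components of \<open>\<nu>\<close> (the columns of \<open>D\<^sub>c\<close>) are indexed by pairs of a cell and an edge of the
  communication graph of that cell.
\<close>

record ('v, 'k, 'e) network =
  grid :: "'v pair_pre_digraph"
  generators :: "'v set"
  inverters :: "'v set"
  loads :: "'v set"
  inertia :: "'v \<Rightarrow> real"                    \<comment> \<open>\<open>M\<^sub>i\<close>\<close>
  damping :: "'v \<Rightarrow> real"                    \<comment> \<open>\<open>A\<^sub>i\<close>\<close>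
  tau_d :: "'v \<Rightarrow> real"
  reactance :: "'v \<Rightarrow> real"                  \<comment> \<open>\<open>X\<^sub>d\<^sub>,\<^sub>i\<close>\<close>
  transient_reactance :: "'v \<Rightarrow> real"        \<comment> \<open>\<open>X'\<^sub>d\<^sub>,\<^sub>i\<close>\<close>
  line_B :: "'v \<Rightarrow> 'v \<Rightarrow> real"
  line_G :: "'v \<Rightarrow> 'v \<Rightarrow> real"
  shunt_b :: "'v \<Rightarrow> real"
  shunt_g :: "'v \<Rightarrow> real"
  load_p :: "'v \<Rightarrow> real"
  load_q :: "'v \<Rightarrow> real"
  node_cost :: "'v \<Rightarrow> real \<Rightarrow> real"           \<comment> \<open>\<open>C\<^sub>i\<close>\<close>
  pg_lower :: "'v \<Rightarrow> real"
  pg_upper :: "'v \<Rightarrow> real"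
  Uf_lower :: "'v \<Rightarrow> real"
  Uf_upper :: "'v \<Rightarrow> real"
  UI_lower :: "'v \<Rightarrow> real"
  UI_upper :: "'v \<Rightarrow> real"
  tau_g :: "'v \<Rightarrow> real"
  tau_UG :: "'v \<Rightarrow> real"
  tau_UI :: "'v \<Rightarrow> real"
  tau_mu_g_minus :: "'v \<Rightarrow> real"
  tau_mu_g_plus :: "'v \<Rightarrow> real"
  tau_mu_G_minus :: "'v \<Rightarrow> real"
  tau_mu_G_plus :: "'v \<Rightarrow> real"
  tau_mu_I_minus :: "'v \<Rightarrow> real"
  tau_mu_I_plus :: "'v \<Rightarrow> real"
  tau_lambda :: "'v \<Rightarrow> real"
  tau_nu :: "'k \<times> 'e \<Rightarrow> real"
  cell_index :: "'k set"
  cell :: "'k \<Rightarrow> 'v set"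
  comm_graph :: "'k \<Rightarrow> ('v, 'e) pre_digraph"

record ('v, 'k, 'e) state =
  theta :: "'v \<Rightarrow> 'v \<Rightarrow> real"
  ang_mom :: "'v \<Rightarrow> real"                    \<comment> \<open>\<open>L\<^sub>i\<close>\<close>
  omega :: "'v \<Rightarrow> real"
  volt :: "'v \<Rightarrow> real"                       \<comment> \<open>\<open>U\<^sub>i\<close>\<close>
  exc_volt :: "'v \<Rightarrow> real"                   \<comment> \<open>\<open>U\<^sub>f\<^sub>,\<^sub>i\<close>\<close>
  gen_p :: "'v \<Rightarrow> real"                      \<comment> \<open>\<open>p\<^sub>g\<^sub>,\<^sub>i\<close>\<close>
  mu_g_minus :: "'v \<Rightarrow> real"
  mu_g_plus :: "'v \<Rightarrow> real"
  mu_G_minus :: "'v \<Rightarrow> real"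
  mu_G_plus :: "'v \<Rightarrow> real"
  mu_I_minus :: "'v \<Rightarrow> real"
  mu_I_plus :: "'v \<Rightarrow> real"
  price :: "'v \<Rightarrow> real"                      \<comment> \<open>\<open>\<lambda>\<^sub>i\<close>\<close>
  nu :: "'k \<times> 'e \<Rightarrow> real"

definition nodes :: "('v, 'k, 'e) network \<Rightarrow> 'v set" where
  "nodes N = pverts (grid N)"

definition neighbours :: "('v, 'k, 'e) network \<Rightarrow> 'v \<Rightarrow> 'v set" where
  "neighbours N i = {j. (i, j) \<in> parcs (grid N) \<or> (j, i) \<in> parcs (grid N)}"

definition comm_edges :: "('v, 'k, 'e) network \<Rightarrow> ('k \<times> 'e) set" where
  "comm_edges N = (SIGMA k : cell_index N. arcs (comm_graph N k))"

definition incidence :: "('v, 'e) pre_digraph \<Rightarrow> 'v \<Rightarrow> 'e \<Rightarrow> real" where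
  "incidence H i e = (if i = tail H e then 1 else if i = head H e then - 1 else 0)"

definition Dc :: "('v, 'k, 'e) network \<Rightarrow> 'v \<Rightarrow> 'k \<times> 'e \<Rightarrow> real" where
  "Dc N i = (\<lambda>(k, e). if i \<in> cell N k then incidence (comm_graph N k) i e else 0)"

text \<open>\<open>Digraph_Component.connected\<close> is connectedness of the underlying undirected graph.\<close>

definition valid_network :: "('v, 'k, 'e) network \<Rightarrow> bool" where
  "valid_network N \<longleftrightarrow>
     pair_fin_digraph (grid N) \<and> Digraph_Component.connected (with_proj (grid N)) \<and>
     nodes N = generators N \<union> inverters N \<union> loads N \<and>
     generators N \<inter> inverters N = {} \<and> generators N \<inter> loads N = {} \<and>
     inverters N \<inter> loads N = {} \<and>
     (\<forall>i \<in> generators N \<union> inverters N. inertia N i > 0) \<and>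
     (\<forall>i \<in> nodes N. damping N i > 0) \<and>
     (\<forall>i \<in> generators N. tau_d N i > 0) \<and>
     (\<forall>i \<in> nodes N. \<forall>j \<in> neighbours N i. line_B N i j = line_B N j i \<and> line_G N i j = line_G N j i) \<and>
     (\<forall>i \<in> nodes N. line_B N i i = - shunt_b N i - (\<Sum>j \<in> neighbours N i. line_B N i j)) \<and>
     (\<forall>i \<in> nodes N. line_G N i i = - shunt_g N i - (\<Sum>j \<in> neighbours N i. line_G N i j)) \<and>
     (\<forall>i \<in> generators N \<union> inverters N.
        convex_on UNIV (node_cost N i) \<and> (\<forall>s. node_cost N i differentiable (at s))) \<and>
     (\<forall>i \<in> generators N \<union> inverters N.
        tau_g N i > 0 \<and> tau_mu_g_minus N i > 0 \<and> tau_mu_g_plus N i > 0) \<and>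
     (\<forall>i \<in> generators N. tau_UG N i > 0 \<and> tau_mu_G_minus N i > 0 \<and> tau_mu_G_plus N i > 0) \<and>
     (\<forall>i \<in> inverters N. tau_UI N i > 0 \<and> tau_mu_I_minus N i > 0 \<and> tau_mu_I_plus N i > 0) \<and>
     (\<forall>i \<in> nodes N. tau_lambda N i > 0) \<and>
     (\<forall>c \<in> comm_edges N. tau_nu N c > 0) \<and>
     nodes N = (\<Union>k \<in> cell_index N. cell N k) \<and> disjoint_family_on (cell N) (cell_index N) \<and>
     (\<forall>k \<in> cell_index N.
        fin_digraph (comm_graph N k) \<and> loopfree_digraph (comm_graph N k) \<and>
        verts (comm_graph N k) = cell N k \<and> Digraph_Component.connected (comm_graph N k))"

definition phi :: "('v, 'k, 'e) network \<Rightarrow> ('v, 'k, 'e) state \<Rightarrow> 'v \<Rightarrow> real" where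
  "phi N x i = line_G N i i * (volt x i)\<^sup>2 +
     (\<Sum>j \<in> neighbours N i. line_G N i j * volt x i * volt x j * cos (theta x i j))"

definition active_p :: "('v, 'k, 'e) network \<Rightarrow> ('v, 'k, 'e) state \<Rightarrow> 'v \<Rightarrow> real" where
  "active_p N x i =
     (\<Sum>j \<in> neighbours N i. line_B N i j * volt x i * volt x j * sin (theta x i j)) +
     line_G N i i * (volt x i)\<^sup>2 +
     (\<Sum>j \<in> neighbours N i. line_G N i j * volt x i * volt x j * cos (theta x i j))"

definition reactive_q :: "('v, 'k, 'e) network \<Rightarrow> ('v, 'k, 'e) state \<Rightarrow> 'v \<Rightarrow> real" where
  "reactive_q N x i =
     - (\<Sum>j \<in> neighbours N i. line_B N i j * volt x i * volt x j * cos (theta x i j)) +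
     line_B N i i * (volt x i)\<^sup>2 +
     (\<Sum>j \<in> neighbours N i. line_G N i j * volt x i * volt x j * sin (theta x i j))"

definition total_cost :: "('v, 'k, 'e) network \<Rightarrow> ('v \<Rightarrow> real) \<Rightarrow> real" where
  "total_cost N p = (\<Sum>i \<in> generators N \<union> inverters N. node_cost N i (p i))"

definition grad_cost :: "('v, 'k, 'e) network \<Rightarrow> ('v \<Rightarrow> real) \<Rightarrow> 'v \<Rightarrow> real" where
  "grad_cost N p i = deriv (\<lambda>s. total_cost N (p(i := s))) (p i)"

definition gen_p_ext :: "('v, 'k, 'e) network \<Rightarrow> ('v, 'k, 'e) state \<Rightarrow> 'v \<Rightarrow> real" where
  "gen_p_ext N x i = (if i \<in> generators N \<union> inverters N then gen_p x i else 0)"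

definition proj_pos :: "real \<Rightarrow> real \<Rightarrow> real" where
  "proj_pos \<mu> s = (if \<mu> > 0 \<or> s \<ge> 0 then s else 0)"

definition admissible_state :: "('v, 'k, 'e) network \<Rightarrow> ('v, 'k, 'e) state \<Rightarrow> bool" where
  "admissible_state N x \<longleftrightarrow>
     (\<forall>i \<in> nodes N. \<forall>j \<in> neighbours N i. theta x j i = - theta x i j) \<and>
     (\<forall>i \<in> nodes N. volt x i > 0) \<and>
     (\<forall>i \<in> generators N \<union> inverters N. ang_mom x i = inertia N i * omega x i) \<and>
     (\<forall>i \<in> generators N \<union> inverters N. mu_g_minus x i \<ge> 0 \<and> mu_g_plus x i \<ge> 0) \<and>
     (\<forall>i \<in> generators N. mu_G_minus x i \<ge> 0 \<and> mu_G_plus x i \<ge> 0) \<and>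
     (\<forall>i \<in> inverters N. mu_I_minus x i \<ge> 0 \<and> mu_I_plus x i \<ge> 0)"

text \<open>
  The closed loop is a differential-algebraic system, stated as a relation between the state \<open>x\<close>
  and its time derivative \<open>v\<close>; the components of \<open>v\<close> that belong to algebraic variables do not occur.
\<close>

definition physical_model ::
    "('v, 'k, 'e) network \<Rightarrow> ('v, 'k, 'e) state \<Rightarrow> ('v, 'k, 'e) state \<Rightarrow> bool" where
  "physical_model N x v \<longleftrightarrow>
     (\<forall>(i, j) \<in> parcs (grid N). theta v i j = omega x i - omega x j) \<and>
     (\<forall>i \<in> generators N \<union> inverters N.
        ang_mom v i = - damping N i * omega x i + gen_p x i - load_p N i - active_p N x i) \<and>
     (\<forall>i \<in> generators N.
        tau_d N i * volt v i = exc_volt x i - volt x i -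
          (reactance N i - transient_reactance N i) * inverse (volt x i) * reactive_q N x i) \<and>
     (\<forall>i \<in> loads N.
        0 = - damping N i * omega x i - load_p N i - active_p N x i \<and>
        0 = - load_q N i - reactive_q N x i)"

definition controller ::
    "('v, 'k, 'e) network \<Rightarrow> ('v, 'k, 'e) state \<Rightarrow> ('v, 'k, 'e) state \<Rightarrow> bool" where
  "controller N x v \<longleftrightarrow>
     (\<forall>i \<in> generators N \<union> inverters N.
        tau_g N i * gen_p v i = - grad_cost N (gen_p x) i + price x i - omega x i
          + mu_g_minus x i - mu_g_plus x i \<and>
        tau_mu_g_minus N i * mu_g_minus v i =
          proj_pos (mu_g_minus x i) (pg_lower N i - gen_p x i) \<and>
        tau_mu_g_plus N i * mu_g_plus v i =
          proj_pos (mu_g_plus x i) (gen_p x i - pg_upper N i)) \<and>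
     (\<forall>i \<in> generators N.
        tau_UG N i * exc_volt v i = mu_G_minus x i - mu_G_plus x i \<and>
        tau_mu_G_minus N i * mu_G_minus v i =
          proj_pos (mu_G_minus x i) (Uf_lower N i - exc_volt x i) \<and>
        tau_mu_G_plus N i * mu_G_plus v i =
          proj_pos (mu_G_plus x i) (exc_volt x i - Uf_upper N i)) \<and>
     (\<forall>i \<in> inverters N.
        tau_UI N i * volt v i = - mu_I_minus x i + mu_I_plus x i \<and>
        tau_mu_I_minus N i * mu_I_minus v i =
          proj_pos (mu_I_minus x i) (UI_lower N i - volt x i) \<and>
        tau_mu_I_plus N i * mu_I_plus v i =
          proj_pos (mu_I_plus x i) (volt x i - UI_upper N i)) \<and>
     (\<forall>i \<in> nodes N.
        tau_lambda N i * price v i = - gen_p_ext N x i + phi N x i + load_p N i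
          - (\<Sum>c \<in> comm_edges N. Dc N i c * nu x c)) \<and>
     (\<forall>c \<in> comm_edges N. tau_nu N c * nu v c = (\<Sum>i \<in> nodes N. Dc N i c * price x i))"

definition closed_loop ::
    "('v, 'k, 'e) network \<Rightarrow> ('v, 'k, 'e) state \<Rightarrow> ('v, 'k, 'e) state \<Rightarrow> bool" where
  "closed_loop N x v \<longleftrightarrow> physical_model N x v \<and> controller N x v"

definition zero_rate :: "('v, 'k, 'e) state" where
  "zero_rate = \<lparr> theta = (\<lambda>_ _. 0), ang_mom = (\<lambda>_. 0), omega = (\<lambda>_. 0), volt = (\<lambda>_. 0),
     exc_volt = (\<lambda>_. 0), gen_p = (\<lambda>_. 0), mu_g_minus = (\<lambda>_. 0), mu_g_plus = (\<lambda>_. 0),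
     mu_G_minus = (\<lambda>_. 0), mu_G_plus = (\<lambda>_. 0), mu_I_minus = (\<lambda>_. 0), mu_I_plus = (\<lambda>_. 0),
     price = (\<lambda>_. 0), nu = (\<lambda>_. 0) \<rparr>"

definition equilibrium :: "('v, 'k, 'e) network \<Rightarrow> ('v, 'k, 'e) state \<Rightarrow> bool" where
  "equilibrium N x \<longleftrightarrow> admissible_state N x \<and> closed_loop N x zero_rate"

end

theory Submission
  imports Defs
begin

text \<open>
  At an equilibrium the angle equations make \<open>\<omega>\<close> constant on the connected physical network.
  Subtracting the \<open>\<lambda>\<close>-equation from the power balance cancels generation, consumption and the
  line losses \<open>\<phi>\<^sub>i\<close>; what remains, summed over all nodes, is \<open>\<Sum>\<^sub>i A\<^sub>i \<omega>\<^sub>i = 0\<close>, because the lossless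
  flows \<open>B\<^sub>i\<^sub>j U\<^sub>i U\<^sub>j sin \<theta>\<^sub>i\<^sub>j\<close> are antisymmetric and the columns of \<open>D\<^sub>c\<close> sum to zero.  As all
  \<open>A\<^sub>i\<close> are positive, the common value of \<open>\<omega>\<close> vanishes.
\<close>

text \<open>Connectedness joins \<open>u\<close> to \<open>v\<close> by a walk in the symmetric
  closure of the arcs. Equality of values is symmetric, so it passes along each step whatever the
  direction of the arc.\<close>

lemma connected_imp_constant:
  assumes "Digraph_Component.connected G"
    and "\<And>i j. (i, j) \<in> arcs_ends G \<Longrightarrow> f i = f j"
    and "u \<in> verts G" "v \<in> verts G"
  shows "f u = f v"
proof -
  have "(u, v) \<in> rtrancl_on (verts G) ((arcs_ends G)\<^sup>s)"
    using assms(1,3,4) by (simp add: connected_conv)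
  then show ?thesis
    by (induction rule: rtrancl_on_induct) (auto simp: symcl_def dest: assms(2))
qed

text \<open>Symmetry of \<open>R\<close> makes swapping the two components a bijection of
  \<open>Sigma V R\<close>. The double sum therefore equals its own negative.\<close>

lemma sum_antisymmetric_eq_0:
  fixes f :: "'a \<Rightarrow> 'a \<Rightarrow> real"
  assumes "\<And>i. i \<in> V \<Longrightarrow> R i \<subseteq> V"
    and "\<And>i j. j \<in> R i \<Longrightarrow> i \<in> R j"
    and "\<And>i j. i \<in> V \<Longrightarrow> j \<in> R i \<Longrightarrow> f j i = - f i j"
    and "finite V"
  shows "(\<Sum>i\<in>V. \<Sum>j\<in>R i. f i j) = 0"
proof -
  have fin: "finite (R i)" if "i \<in> V" for i
    using assms(1,4) that finite_subset by blast
  have "(\<Sum>i\<in>V. \<Sum>j\<in>R i. f i j) = (\<Sum>(i, j)\<in>Sigma V R. f i j)"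
    using assms(4) fin by (simp add: sum.Sigma)
  also have "\<dots> = (\<Sum>(i, j)\<in>Sigma V R. f j i)"
    by (rule sum.reindex_bij_witness[of _ prod.swap prod.swap])
      (use assms(2) in \<open>auto dest: assms(1)[THEN subsetD]\<close>)
  also have "\<dots> = (\<Sum>(i, j)\<in>Sigma V R. - f i j)"
    by (rule sum.cong) (use assms(3) in auto)
  also have "\<dots> = - (\<Sum>(i, j)\<in>Sigma V R. f i j)"
    by (simp add: case_prod_unfold sum_negf)
  also have "(\<Sum>(i, j)\<in>Sigma V R. f i j) = (\<Sum>i\<in>V. \<Sum>j\<in>R i. f i j)"
    using assms(4) fin by (simp add: sum.Sigma)
  finally show ?thesis by simp
qed

lemma finite_nodes:
  assumes "valid_network N"
  shows "finite (nodes N)"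
proof -
  interpret pair_fin_digraph "grid N" using assms by (simp add: valid_network_def)
  show ?thesis by (simp add: nodes_def pair_finite_verts)
qed

lemma neighbours_subset_nodes:
  assumes "valid_network N"
  shows "neighbours N i \<subseteq> nodes N"
proof -
  interpret pair_fin_digraph "grid N" using assms by (simp add: valid_network_def)
  show ?thesis by (auto simp: neighbours_def nodes_def dest: in_arcsD1 in_arcsD2)
qed

lemma neighbours_sym: "j \<in> neighbours N i \<Longrightarrow> i \<in> neighbours N j"
  by (auto simp: neighbours_def)

lemma sum_incidence_eq_0:
  assumes "loopfree_digraph H" and "e \<in> arcs H"
    and "finite S" and "tail H e \<in> S" and "head H e \<in> S"
  shows "(\<Sum>i\<in>S. incidence H i e) = 0"
proof -
  interpret loopfree_digraph H by fact
  \<comment> \<open>The nested conditional of \<open>incidence\<close> would give 1 at a loop, where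
    this difference gives 0; the two agree because tail and head are distinct.\<close>
  have "incidence H i e = of_bool (i = tail H e) - of_bool (i = head H e)" for i
    using no_loops[OF assms(2)] by (auto simp: incidence_def)
  then show ?thesis
    using assms(3-5) by (simp add: sum_subtractf of_bool_def)
qed

lemma sum_Dc_column_eq_0:
  assumes N: "valid_network N" and c: "c \<in> comm_edges N"
  shows "(\<Sum>i\<in>nodes N. Dc N i c) = 0"
proof -
  obtain k e where ke: "c = (k, e)" "k \<in> cell_index N" "e \<in> arcs (comm_graph N k)"
    using c by (auto simp: comm_edges_def)
  have sub: "cell N k \<subseteq> nodes N"
    and verts: "verts (comm_graph N k) = cell N k"
    and lf: "loopfree_digraph (comm_graph N k)" and fd: "fin_digraph (comm_graph N k)"
    using N ke(2) unfolding valid_network_def by auto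
  have ends: "finite (cell N k)" "tail (comm_graph N k) e \<in> cell N k" "head (comm_graph N k) e \<in> cell N k"
  proof -
    interpret fin_digraph "comm_graph N k" by fact
    show "finite (cell N k)" using finite_verts verts by simp
    show "tail (comm_graph N k) e \<in> cell N k" "head (comm_graph N k) e \<in> cell N k"
      using tail_in_verts[OF ke(3)] head_in_verts[OF ke(3)] verts by simp_all
  qed
  \<comment> \<open>By block-diagonality the column of \<open>(k, e)\<close> vanishes outside cell
    \<open>k\<close>.\<close>
  have "(\<Sum>i\<in>nodes N. Dc N i c) = (\<Sum>i\<in>cell N k. incidence (comm_graph N k) i e)"
    using finite_nodes[OF N] sub
    by (simp add: ke(1) Dc_def sum.If_cases Int_absorb1)
  also have "\<dots> = 0"
    by (rule sum_incidence_eq_0[OF lf ke(3) ends])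
  finally show ?thesis .
qed

text \<open>The two injections differ by the lossless flows, which are antisymmetric:
  \<open>line_B\<close> is symmetric, the angle differences change sign, and sine is odd. These
  flows cancel over the whole network.\<close>

lemma sum_active_p_eq_sum_phi:
  assumes N: "valid_network N" and x: "admissible_state N x"
  shows "(\<Sum>i\<in>nodes N. active_p N x i) = (\<Sum>i\<in>nodes N. phi N x i)"
proof -
  define f where "f i j = line_B N i j * volt x i * volt x j * sin (theta x i j)" for i j
  have "f j i = - f i j" if "i \<in> nodes N" "j \<in> neighbours N i" for i j
  proof -
    have "line_B N i j = line_B N j i" using N that unfolding valid_network_def by blast
    moreover have "theta x j i = - theta x i j"
      using x that unfolding admissible_state_def by blast
    ultimately show ?thesis by (simp add: f_def)
  qed
  then have "(\<Sum>i\<in>nodes N. \<Sum>j\<in>neighbours N i. f i j) = 0"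
    using neighbours_subset_nodes[OF N] neighbours_sym finite_nodes[OF N]
    by (intro sum_antisymmetric_eq_0) auto
  moreover have "active_p N x i = (\<Sum>j\<in>neighbours N i. f i j) + phi N x i" for i
    by (simp add: active_p_def phi_def f_def)
  ultimately show ?thesis by (simp add: sum.distrib)
qed

theorem proposition1:
  fixes N :: "('v, 'k, 'e) network" and x :: "('v, 'k, 'e) state"
  assumes "valid_network N" and "equilibrium N x"
  shows "\<forall>i \<in> nodes N. omega x i = 0"
proof
  fix i assume i: "i \<in> nodes N"
  note N = assms(1)
  have x: "admissible_state N x" and phys: "physical_model N x zero_rate"
    and ctrl: "controller N x zero_rate"
    using assms(2) by (auto simp: equilibrium_def closed_loop_def)
  have nodes: "nodes N = generators N \<union> inverters N \<union> loads N"
    and conn: "Digraph_Component.connected (with_proj (grid N))"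
    and damping: "\<And>j. j \<in> nodes N \<Longrightarrow> damping N j > 0"
    using N by (auto simp: valid_network_def)

  have "omega x j = omega x l" if "(j, l) \<in> arcs_ends (with_proj (grid N))" for j l
    using phys that by (auto simp: physical_model_def zero_rate_def)
  then have const: "omega x j = omega x i" if "j \<in> nodes N" for j
    by (rule connected_imp_constant[OF conn]) (use i that in \<open>auto simp: nodes_def\<close>)

  \<comment> \<open>Extending generation by zero to the loads merges the differential equations, at
    rate zero, and the algebraic ones into one balance for all nodes.\<close>
  have power: "damping N j * omega x j = gen_p_ext N x j - load_p N j - active_p N x j"
    if "j \<in> nodes N" for j
  proof (cases "j \<in> generators N \<union> inverters N")
    case True
    then have "0 = - damping N j * omega x j + gen_p x j - load_p N j - active_p N x j"
      using phys unfolding physical_model_def zero_rate_def by simp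
    then show ?thesis using True by (simp add: gen_p_ext_def)
  next
    case False
    then have "j \<in> loads N" using that nodes by blast
    then have "0 = - damping N j * omega x j - load_p N j - active_p N x j"
      using phys unfolding physical_model_def by blast
    then show ?thesis using False by (simp add: gen_p_ext_def)
  qed
  have price: "gen_p_ext N x j - load_p N j
      = phi N x j - (\<Sum>c\<in>comm_edges N. Dc N j c * nu x c)" if "j \<in> nodes N" for j
  proof -
    have "0 = - gen_p_ext N x j + phi N x j + load_p N j - (\<Sum>c\<in>comm_edges N. Dc N j c * nu x c)"
      using ctrl that unfolding controller_def zero_rate_def by simp
    then show ?thesis by simp
  qed
  \<comment> \<open>Exchanging the sums exposes the column sums of \<open>Dc\<close>, so the
    multipliers \<open>nu\<close> drop out whatever their values.\<close>
  have "(\<Sum>j\<in>nodes N. \<Sum>c\<in>comm_edges N. Dc N j c * nu x c)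
      = (\<Sum>c\<in>comm_edges N. (\<Sum>j\<in>nodes N. Dc N j c) * nu x c)"
    by (subst sum.swap) (simp add: sum_distrib_right)
  then have Dc: "(\<Sum>j\<in>nodes N. \<Sum>c\<in>comm_edges N. Dc N j c * nu x c) = 0"
    by (simp add: sum_Dc_column_eq_0[OF N])

  have "(\<Sum>j\<in>nodes N. damping N j) * omega x i = (\<Sum>j\<in>nodes N. damping N j * omega x j)"
    by (simp add: sum_distrib_right const)
  also have "\<dots> = (\<Sum>j\<in>nodes N. phi N x j - (\<Sum>c\<in>comm_edges N. Dc N j c * nu x c) - active_p N x j)"
    by (rule sum.cong) (simp_all add: power price)
  also have "\<dots> = 0"
    by (simp add: sum_subtractf Dc sum_active_p_eq_sum_phi[OF N x])
  finally have "(\<Sum>j\<in>nodes N. damping N j) * omega x i = 0" .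
  \<comment> \<open>The node \<open>i\<close> also ensures that this sum of positive terms is not
    empty.\<close>
  moreover have "(\<Sum>j\<in>nodes N. damping N j) > 0"
    using finite_nodes[OF N] i damping by (intro sum_pos) auto
  ultimately show "omega x i = 0" by simp
qed

end
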